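(* Let $c$ be a positive real number, $0<\theta<1$, and $\varepsilon>0$. Then $$\mathrm{E}(z;c,\theta)=C_1(1+z)^{\frac{2-\theta}{2(\theta-1)}}\exp\left(C_2v^{\frac{\theta}{\theta-1}}\right)\left(1+\mathrm{O}((1+z)^\mu)\right)$$ as $z$ tends to $-1^+$ in $\mathbb{R}$, where $v:=-\log|z|$, the positive constants $C_1,C_2$ are $$C_1=\sqrt{2\pi}\,(1-\theta)^{-1/2}(c\theta)^{\frac{1}{2(1-\theta)}},\qquad C_2=\tfrac{1-\theta}{\theta}(c\theta)^{\frac{1}{1-\theta}},$$ and $$\mu=\min\left\{\tfrac{\theta}{2(1-\theta)}-\varepsilon,\ 1\right\}.$$
   Context: $\mathrm{E}(z;c,\theta)=\sum_{n=1}^\infty\mathrm{e}^{cn^\theta}(-z)^n$, which for $0<\theta<1$ converges for $|z|<1$. *)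

theory Defs
  imports Complex_Main "HOL-Library.Landau_Symbols" "HOL-Real_Asymp.Real_Asymp"
begin

(* The series starts at n = 1, hence the shift of the index by Suc. *)
definition E :: "'a::{real_normed_field, banach} \<Rightarrow> 'a \<Rightarrow> real \<Rightarrow> 'a" where
  "E z c \<theta> = (\<Sum>n. exp (c * of_real (real (Suc n) powr \<theta>)) * (- z) ^ Suc n)"

lemma summable_E:
  fixes z c :: "'a::{real_normed_field, banach}"
  assumes "0 < \<theta>" "\<theta> < 1" "norm z < 1"
  shows "summable (\<lambda>n. exp (c * of_real (real (Suc n) powr \<theta>)) * (- z) ^ Suc n)"
proof -
  define b where "b = (1 + norm z) / 2"
  define k where "k = norm c + 1"
  have b: "0 < b" "b < 1" "norm z < b" and k: "k > 0"
    using assms(3) by (auto simp: b_def k_def add_pos_nonneg field_simps)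
  define q where "q = (b + 1) / 2"
  have q: "q > 0" "q < 1" "b < q" using b by (auto simp: q_def)
  have "(\<lambda>n::nat. exp (k * real n powr \<theta>) * b ^ n) \<in> O(\<lambda>n. q ^ n)"
    using assms(1,2) b q k ln_less_cancel_iff[of b q] by real_asymp
  moreover have "summable (\<lambda>n::nat. norm (q ^ n))"
    using q by (simp add: summable_geometric)
  ultimately have "summable (\<lambda>n::nat. exp (k * real n powr \<theta>) * b ^ n)"
    by (rule summable_comparison_test_bigo[rotated])
  moreover have "norm (exp (c * of_real (real n powr \<theta>)) * (- z) ^ n)
      \<le> exp (k * real n powr \<theta>) * b ^ n" for n :: nat
  proof -
    have "norm (exp (c * of_real (real n powr \<theta>))) \<le> exp (norm c * real n powr \<theta>)"
      using norm_exp[of "c * of_real (real n powr \<theta>)"] by (simp add: norm_mult)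
    also have "\<dots> \<le> exp (k * real n powr \<theta>)"
      by (simp add: k_def mult_right_mono)
    finally show ?thesis
      using b by (auto simp: norm_mult norm_power intro!: mult_mono power_mono)
  qed
  ultimately have "summable (\<lambda>n. exp (c * of_real (real n powr \<theta>)) * (- z) ^ n)"
    by (intro summable_comparison_test[where f = "\<lambda>n. exp (c * of_real (real n powr \<theta>)) * (- z) ^ n"]) auto
  thus ?thesis
    by (subst summable_Suc_iff)
qed

definition C1 :: "real \<Rightarrow> real \<Rightarrow> real" where
  "C1 c \<theta> = sqrt (2 * pi) * (1 - \<theta>) powr (- 1 / 2) * (c * \<theta>) powr (1 / (2 * (1 - \<theta>)))"

definition C2 :: "real \<Rightarrow> real \<Rightarrow> real" where
  "C2 c \<theta> = (1 - \<theta>) / \<theta> * (c * \<theta>) powr (1 / (1 - \<theta>))"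

end

theory Submission
  imports Defs "HOL-Probability.Distributions"
begin

text \<open>
  With \<open>z = - exp (- v)\<close>, the series is the sum over \<open>n \<ge> 1\<close> of \<open>exp (c n powr \<theta> - v n)\<close>, to which
  the saddle point method applies. The exponent is maximal at \<open>N = (c \<theta> / v) powr (1 / (1 - \<theta>))\<close>,
  where its value is \<open>C2 c \<theta> v powr (\<theta> / (\<theta> - 1))\<close>. In the variable \<open>t = x / N\<close>, the exponent is this
  maximum minus \<open>l\<close> times a fixed convex function \<open>phase \<theta> t\<close>, which is independent of \<open>v\<close>
  and has its zero and minimum at \<open>t = 1\<close>; all dependence on \<open>v\<close> is in \<open>N\<close> and in the large
  parameter \<open>l = v N\<close> (lemma \<open>exponent_eq_max_minus_phase\<close>).

  Two estimates give the asymptotics. After division by its maximum the summand is unimodal with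
  values in \<open>[0, 1]\<close>, so the sum differs from the integral by at most 2
  (\<open>abs_suminf_minus_integral_le_variation\<close>). Laplace's method shows that the integral of
  \<open>exp (- l phase \<theta> t)\<close> is \<open>\<surd>(2 \<pi> / ((1 - \<theta>) l))\<close> up to \<open>O(1 / l)\<close> (\<open>laplace_method\<close>, applied
  in \<open>phase_integral_asymp\<close>). The main term multiplied by \<open>N\<close> is \<open>C1 c \<theta>\<close> times a power of \<open>v\<close>.
  The relative error is \<open>O(1 / \<surd>l)\<close>, and \<open>l\<close> is a constant times \<open>v powr (- \<theta> / (1 - \<theta>))\<close>. So this
  error has the order of \<open>v\<close> to the power \<open>\<theta> / (2 (1 - \<theta>))\<close>, which exceeds the first component of the
  minimum in the exponent of the error term by \<open>\<epsilon>\<close>.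

  The second component arises because the power in the prefactor is one of \<open>1 + z\<close> and not of \<open>v\<close>:
  since \<open>v = - ln (1 - (1 + z))\<close>, their ratio is \<open>1 + O(1 + z)\<close>. In the exponential factor such a
  replacement would not be harmless, and there \<open>v\<close> is kept.
\<close>

section \<open>Sums and integrals of functions of bounded variation\<close>

text \<open>
  On each cell \<open>(n, n + 1]\<close> the function stays within \<open>V (n + 1) - V n\<close> of its value at the right
  endpoint, so the error made by replacing the integral over the cell by that value is at most this
  difference. The differences telescope. Formulating the bound by a variation function \<open>V\<close> avoids a
  separate treatment of the cell that contains the maximum of a unimodal function.
\<close>
lemma abs_suminf_minus_integral_le_variation:
  fixes f V :: "real \<Rightarrow> real"
  assumes int: "set_integrable lborel {0..} f"
    and summ: "summable (\<lambda>n. f (real (Suc n)))"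
    and var: "\<And>x y. 0 \<le> x \<Longrightarrow> x \<le> y \<Longrightarrow> \<bar>f x - f y\<bar> \<le> V y - V x"
    and bounds: "\<And>x. 0 \<le> x \<Longrightarrow> 0 \<le> V x \<and> V x \<le> B"
  shows "\<bar>(\<Sum>n. f (real (Suc n))) - (LINT x:{0..}|lborel. f x)\<bar> \<le> B"
proof -
  have int_sub: "set_integrable lborel S f" if "S \<subseteq> {0..}" "S \<in> sets borel" for S
    using set_integrable_subset[OF int] that by simp
  have cell: "\<bar>f (real (Suc n)) - (LINT x:{real n<..real (Suc n)}|lborel. f x)\<bar>
      \<le> V (real (Suc n)) - V (real n)" for n
  proof -
    let ?S = "{real n<..real (Suc n)}"
    have const: "set_integrable lborel ?S (\<lambda>x. k)" "(LINT x:?S|lborel. k) = k" for k :: real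
      by (simp_all add: set_integrable_def set_lebesgue_integral_def)
    have fS: "set_integrable lborel ?S f" by (rule int_sub) auto
    have "f (real (Suc n)) - (LINT x:?S|lborel. f x) = (LINT x:?S|lborel. f (real (Suc n)) - f x)"
      using set_integral_diff(2)[OF const(1) fS, of "f (real (Suc n))"] const(2)[of "f (real (Suc n))"] by simp
    also have "\<bar>\<dots>\<bar> \<le> (LINT x:?S|lborel. \<bar>f (real (Suc n)) - f x\<bar>)"
      using set_integral_norm_bound[of lborel ?S "\<lambda>x. f (real (Suc n)) - f x"]
        set_integral_diff(1)[OF const(1) fS] by simp
    also have "\<dots> \<le> (LINT x:?S|lborel. V (real (Suc n)) - V (real n))"
    proof (rule set_integral_mono)
      show "set_integrable lborel ?S (\<lambda>x. \<bar>f (real (Suc n)) - f x\<bar>)"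
        by (intro set_integrable_abs set_integral_diff(1) const fS)
      fix x assume "x \<in> ?S"
      thus "\<bar>f (real (Suc n)) - f x\<bar> \<le> V (real (Suc n)) - V (real n)"
        using var[of "real n" x] var[of x "real (Suc n)"] by fastforce
    qed (rule const)
    finally show ?thesis by (simp only: const)
  qed
  have partial: "\<bar>(\<Sum>n<T. f (real (Suc n))) - (LINT x:{0..real T}|lborel. f x)\<bar>
      \<le> V (real T) - V 0" for T
  proof (induction T)
    case 0
    have "(LINT x:{0..0}|lborel. f x) = 0"
      unfolding set_lebesgue_integral_def
      by (rule integral_eq_zero_AE, rule AE_I'[of "{0}"]) (auto simp: indicator_def)
    thus ?case by simp
  next
    case (Suc T)
    have "{0..real (Suc T)} = {0..real T} \<union> {real T<..real (Suc T)}" by auto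
    hence "(LINT x:{0..real (Suc T)}|lborel. f x)
        = (LINT x:{0..real T}|lborel. f x) + (LINT x:{real T<..real (Suc T)}|lborel. f x)"
      by (simp only:) (rule set_integral_Un; (rule int_sub)?; auto)
    thus ?case using Suc.IH cell[of T] by simp
  qed
  have "(\<lambda>T. LINT x:{0..real T}|lborel. f x) \<longlonglongrightarrow> (LINT x:{0..}|lborel. f x)"
  proof -
    have "(\<lambda>T. LINT x|lborel. indicator {..real T} x *\<^sub>R (indicator {0..} x *\<^sub>R f x))
        \<longlonglongrightarrow> (LINT x|lborel. indicator {0..} x *\<^sub>R f x)"
      using tendsto_integral_at_top[OF _ int[unfolded set_integrable_def]]
      by (rule filterlim_compose[OF _ filterlim_real_sequentially]) simp
    moreover have "indicator {..real T} x *\<^sub>R (indicator {0..} x *\<^sub>R f x)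
        = indicator {0..real T} x *\<^sub>R f x" for T x
      by (auto simp: indicator_def)
    ultimately show ?thesis by (simp only: set_lebesgue_integral_def)
  qed
  with summable_LIMSEQ[OF summ]
  have "(\<lambda>T. \<bar>(\<Sum>n<T. f (real (Suc n))) - (LINT x:{0..real T}|lborel. f x)\<bar>) \<longlonglongrightarrow>
      \<bar>(\<Sum>n. f (real (Suc n))) - (LINT x:{0..}|lborel. f x)\<bar>"
    by (intro tendsto_intros)
  thus ?thesis
  proof (rule Lim_bounded, intro allI impI)
    show "\<bar>(\<Sum>n<T. f (real (Suc n))) - (LINT x:{0..real T}|lborel. f x)\<bar> \<le> B" for T
      using partial[of T] bounds[of 0] bounds[of "real T"] by simp
  qed
qed

section \<open>Laplace's method with a rate\<close>

text \<open>
  Mean value theorem for the exponential; \<open>m\<close> is a common lower bound of the two exponents, so the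
  estimate keeps the decay and not only the size of the difference.
\<close>
lemma abs_exp_diff_le:
  fixes a b m l :: real
  assumes "0 \<le> l" "m \<le> a" "m \<le> b"
  shows "\<bar>exp (- l * a) - exp (- l * b)\<bar> \<le> l * \<bar>a - b\<bar> * exp (- l * m)"
  using assms
proof (induction a b rule: linorder_wlog)
  case (le a b)
  have "exp (- l * a) - exp (- l * b) = exp (- l * a) * (1 - exp (- l * (b - a)))"
    by (simp add: algebra_simps flip: exp_add)
  also have "\<dots> \<le> exp (- l * a) * (l * (b - a))"
    using exp_ge_add_one_self[of "- l * (b - a)"] by (intro mult_left_mono) auto
  also have "\<dots> \<le> exp (- l * m) * (l * (b - a))"
    using le by (intro mult_right_mono) (auto intro: mult_left_mono)
  finally have "exp (- l * a) - exp (- l * b) \<le> exp (- l * m) * (l * (b - a))" .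
  moreover have "exp (- l * b) \<le> exp (- l * a)" using le by (auto intro: mult_left_mono)
  ultimately show ?case using le(1) by (simp add: mult_ac abs_if)
next
  case (sym a b) thus ?case by (simp add: abs_minus_commute)
qed

lemma integrable_abs_cube_gaussian:
  assumes "0 < (d::real)"
  shows "integrable lborel (\<lambda>w::real. \<bar>w\<bar> ^ 3 * exp (- d * w\<^sup>2))"
proof -
  define \<sigma> where "\<sigma> = 1 / sqrt (2 * d)"
  have \<sigma>: "\<sigma> > 0" "\<sigma>\<^sup>2 = 1 / (2 * d)" using assms by (simp_all add: \<sigma>_def power_divide)
  have "integrable lborel (\<lambda>w. sqrt (2 * pi * \<sigma>\<^sup>2) * (normal_density 0 \<sigma> w * \<bar>w - 0\<bar> ^ 3))"
    using integrable_normal_moment_abs[OF \<sigma>(1)] by (intro integrable_mult_right)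
  also have "(\<lambda>w. sqrt (2 * pi * \<sigma>\<^sup>2) * (normal_density 0 \<sigma> w * \<bar>w - 0\<bar> ^ 3))
      = (\<lambda>w. \<bar>w\<bar> ^ 3 * exp (- d * w\<^sup>2))"
    using \<sigma>(1) assms by (auto simp: normal_density_def \<sigma>(2))
  finally show ?thesis .
qed

lemma integrable_exp_minus_abs:
  assumes "0 < (d::real)"
  shows "integrable lborel (\<lambda>w::real. exp (- d * \<bar>w\<bar>))"
proof -
  have "set_integrable lebesgue {0..} (\<lambda>x. exp (- d * x))"
    using assms by (intro nonnegative_absolutely_integrable_1 integrable_on_exp_minus_to_infinity) auto
  hence "integrable lborel (\<lambda>x. indicator {0..} x *\<^sub>R exp (- d * x))"
    unfolding set_integrable_def by (subst (asm) integrable_completion) simp_all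
  also have "(\<lambda>x. indicator {0..} x *\<^sub>R exp (- d * x))
      = (\<lambda>x. indicator {0..} x *\<^sub>R exp (- d * \<bar>x\<bar>))"
    by (auto simp: indicator_def)
  finally have "integrable lborel (\<lambda>x. indicator {0..} x *\<^sub>R exp (- d * \<bar>x\<bar>))" .
  hence "has_bochner_integral lborel (\<lambda>x. indicator {0..} x *\<^sub>R exp (- d * \<bar>x\<bar>))
     (LINT x|lborel. indicator {0..} x *\<^sub>R exp (- d * \<bar>x\<bar>))"
    by (rule has_bochner_integral_integrable)
  from has_bochner_integral_even_function[OF this] show ?thesis
    by (auto dest: integrable.intros)
qed

lemma integral_gaussian:
  assumes "0 < (a::real)"
  shows "integrable lborel (\<lambda>t::real. exp (- a * (t - p)\<^sup>2 / 2))"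
    and "(LINT t|lborel. exp (- a * (t - p)\<^sup>2 / 2)) = sqrt (2 * pi / a)"
proof -
  define \<sigma> where "\<sigma> = 1 / sqrt a"
  have \<sigma>: "\<sigma> > 0" "\<sigma>\<^sup>2 = 1 / a" using assms by (simp_all add: \<sigma>_def power_divide)
  have eq: "exp (- a * (t - p)\<^sup>2 / 2) = sqrt (2 * pi / a) * normal_density p \<sigma> t" for t
    using \<sigma>(1) assms by (simp add: normal_density_def \<sigma>(2))
  show "integrable lborel (\<lambda>t::real. exp (- a * (t - p)\<^sup>2 / 2))"
    unfolding eq using \<sigma>(1) by (intro integrable_mult_right integrable_normal_density)
  show "(LINT t|lborel. exp (- a * (t - p)\<^sup>2 / 2)) = sqrt (2 * pi / a)"
    unfolding eq using \<sigma>(1) by simp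
qed

text \<open>
  Write \<open>u = t - p\<close>. The integrand and the Gaussian \<open>exp (- \<kappa> l u\<^sup>2 / 2)\<close>, whose integral is the
  main term, are compared pointwise. For \<open>\<bar>u\<bar> \<le> r\<close> the exponents differ by at most \<open>l K \<bar>u\<bar>\<^sup>3\<close>
  while both functions are at most \<open>exp (- l d u\<^sup>2)\<close>; for \<open>\<bar>u\<bar> > r\<close>, the Gaussian and the
  integrand, extended by 0 outside \<open>A\<close>, are at most \<open>exp (- l d \<bar>u\<bar>)\<close>. So the difference is bounded on the whole line by
  \<open>l K \<bar>u\<bar>\<^sup>3 exp (- l d u\<^sup>2) + 2 exp (- l d \<bar>u\<bar>)\<close>. Substituting \<open>w = \<surd>l u\<close> in the first term and
  \<open>w = l u\<close> in the second shows that its integral is a constant divided by \<open>l\<close>. Only the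
  finiteness of the two integrals of \<open>w\<close> matters, not their values.

  Relative to the main term, which has order \<open>1 / \<surd>l\<close>, the error is of order \<open>1 / \<surd>l\<close>. The odd
  cubic term of \<open>g\<close> would cancel in a finer comparison, but this precision suffices here.
\<close>
lemma laplace_method:
  fixes g :: "real \<Rightarrow> real"
  assumes [measurable]: "g \<in> borel_measurable borel" "A \<in> sets borel"
    and pos: "0 < \<kappa>" "0 < \<delta>" "0 \<le> K" "0 < r"
    and sub: "{p - r..p + r} \<subseteq> A"
    and taylor: "\<And>t. \<bar>t - p\<bar> \<le> r \<Longrightarrow> \<bar>g t - \<kappa> * (t - p)\<^sup>2 / 2\<bar> \<le> K * \<bar>t - p\<bar> ^ 3"
    and near: "\<And>t. \<bar>t - p\<bar> \<le> r \<Longrightarrow> \<delta> * (t - p)\<^sup>2 \<le> g t"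
    and far: "\<And>t. t \<in> A \<Longrightarrow> r < \<bar>t - p\<bar> \<Longrightarrow> \<delta> * \<bar>t - p\<bar> \<le> g t"
  shows "\<exists>C\<ge>0. \<forall>l>0. set_integrable lborel A (\<lambda>t. exp (- l * g t)) \<and>
           \<bar>(LINT t:A|lborel. exp (- l * g t)) - sqrt (2 * pi / (\<kappa> * l))\<bar> \<le> C / l"
proof -
  \<comment> \<open>One decay rate for all four estimates: of the integrand and of the Gaussian, near \<open>p\<close> and far
      from it. The Gaussian satisfies the linear bound as \<open>u\<^sup>2 \<ge> r \<bar>u\<bar>\<close> for \<open>\<bar>u\<bar> \<ge> r\<close>.\<close>
  define d where "d = Min {\<delta>, \<kappa> / 2, \<kappa> * r / 2}"
  have d: "0 < d" "d \<le> \<delta>" "d \<le> \<kappa> / 2" "d \<le> \<kappa> * r / 2" using pos by (auto simp: d_def)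
  define J3 where "J3 = (LINT w|lborel. \<bar>w\<bar> ^ 3 * exp (- d * w\<^sup>2))"
  define J1 where "J1 = (LINT w|lborel. exp (- d * \<bar>w\<bar>))"
  have J: "0 \<le> J3" "0 \<le> J1" by (simp_all add: J3_def J1_def)
  show ?thesis
  proof (intro exI[of _ "K * J3 + 2 * J1"] conjI allI impI)
    show "0 \<le> K * J3 + 2 * J1" using J pos by simp
  next
    fix l :: real assume l: "0 < l"
    define F where "F t = indicator A t *\<^sub>R exp (- l * g t)" for t
    define H where "H t = exp (- (\<kappa> * l) * (t - p)\<^sup>2 / 2)" for t
    define s where "s = sqrt l"
    have s: "s > 0" "s * s = l" "s\<^sup>2 = l" using l by (simp_all add: s_def)
    \<comment> \<open>The two terms of the dominating function, in the form required by affine substitution.\<close>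
    define \<Phi> where "\<Phi> t = K / s * (\<bar>- s * p + s * t\<bar> ^ 3 * exp (- d * (- s * p + s * t)\<^sup>2))" for t
    define \<Psi> where "\<Psi> t = 2 * exp (- d * \<bar>- l * p + l * t\<bar>)" for t
    have \<Phi>: "integrable lborel \<Phi>" "integral\<^sup>L lborel \<Phi> = K * J3 / l"
    proof -
      note i = integrable_abs_cube_gaussian[OF d(1)]
      show "integrable lborel \<Phi>" unfolding \<Phi>_def
        using lborel_integrable_real_affine[OF i, of s "- s * p"] s by (intro integrable_mult_right) simp_all
      have "J3 = s * (LINT t|lborel. \<bar>- s * p + s * t\<bar> ^ 3 * exp (- d * (- s * p + s * t)\<^sup>2))"
        unfolding J3_def using lborel_integral_real_affine[of s "\<lambda>w. \<bar>w\<bar> ^ 3 * exp (- d * w\<^sup>2)" "- s * p"] s by simp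
      moreover have "integral\<^sup>L lborel \<Phi> = K / s * (LINT t|lborel. \<bar>- s * p + s * t\<bar> ^ 3 * exp (- d * (- s * p + s * t)\<^sup>2))"
        unfolding \<Phi>_def by simp
      ultimately show "integral\<^sup>L lborel \<Phi> = K * J3 / l" using s by (simp flip: s(2))
    qed
    have \<Psi>: "integrable lborel \<Psi>" "integral\<^sup>L lborel \<Psi> = 2 * J1 / l"
    proof -
      note i = integrable_exp_minus_abs[OF d(1)]
      show "integrable lborel \<Psi>" unfolding \<Psi>_def
        using lborel_integrable_real_affine[OF i, of l "- l * p"] l by (intro integrable_mult_right) simp_all
      have "J1 = l * (LINT t|lborel. exp (- d * \<bar>- l * p + l * t\<bar>))"
        unfolding J1_def using lborel_integral_real_affine[of l "\<lambda>w. exp (- d * \<bar>w\<bar>)" "- l * p"] l by simp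
      moreover have "integral\<^sup>L lborel \<Psi> = 2 * (LINT t|lborel. exp (- d * \<bar>- l * p + l * t\<bar>))"
        unfolding \<Psi>_def by simp
      ultimately show "integral\<^sup>L lborel \<Psi> = 2 * J1 / l" using l by simp
    qed
    have pointwise: "\<bar>F t - H t\<bar> \<le> \<Phi> t + \<Psi> t" for t
    proof -
      define u where "u = t - p"
      have su: "- s * p + s * t = s * u" and lu: "- l * p + l * t = l * u"
        by (simp_all add: u_def algebra_simps)
      have \<Phi>t: "\<Phi> t = l * (K * \<bar>u\<bar> ^ 3) * exp (- l * (d * u\<^sup>2))"
      proof -
        have "\<Phi> t = K / s * (s ^ 3 * \<bar>u\<bar> ^ 3 * exp (- d * (l * u\<^sup>2)))"
          unfolding \<Phi>_def su using s by (simp add: abs_mult power_mult_distrib)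
        also have "s ^ 3 = s * l" using s by (simp add: power3_eq_cube)
        finally show ?thesis using s(1) by (simp add: mult_ac)
      qed
      have \<Psi>t: "\<Psi> t = 2 * exp (- l * (d * \<bar>u\<bar>))"
        unfolding \<Psi>_def lu using l by (simp add: abs_mult mult_ac)
      have Ht: "H t = exp (- l * (\<kappa> * u\<^sup>2 / 2))" by (simp add: H_def u_def mult_ac)
      show ?thesis
      proof (cases "\<bar>u\<bar> \<le> r")
        case True
        hence "t \<in> A" using sub by (auto simp: u_def abs_le_iff)
        hence "\<bar>F t - H t\<bar> = \<bar>exp (- l * g t) - exp (- l * (\<kappa> * u\<^sup>2 / 2))\<bar>" by (simp add: F_def Ht)
        also have "\<dots> \<le> l * \<bar>g t - \<kappa> * u\<^sup>2 / 2\<bar> * exp (- l * (d * u\<^sup>2))"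
        proof (rule abs_exp_diff_le)
          have "d * u\<^sup>2 \<le> \<delta> * u\<^sup>2" using d by (intro mult_right_mono) auto
          thus "d * u\<^sup>2 \<le> g t" using near[of t] True by (simp add: u_def)
          show "d * u\<^sup>2 \<le> \<kappa> * u\<^sup>2 / 2" using mult_right_mono[OF d(3), of "u\<^sup>2"] by simp
        qed (use l in simp)
        also have "\<dots> \<le> l * (K * \<bar>u\<bar> ^ 3) * exp (- l * (d * u\<^sup>2))"
          using taylor[of t] True l by (intro mult_right_mono mult_left_mono) (auto simp: u_def)
        finally have "\<bar>F t - H t\<bar> \<le> \<Phi> t" by (simp add: \<Phi>t)
        moreover have "0 \<le> \<Psi> t" by (simp add: \<Psi>_def)
        ultimately show ?thesis by simp
      next
        case False
        have "F t \<le> exp (- l * (d * \<bar>u\<bar>))"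
        proof (cases "t \<in> A")
          case True
          have "d * \<bar>u\<bar> \<le> \<delta> * \<bar>u\<bar>" using d by (intro mult_right_mono) auto
          also have "\<dots> \<le> g t" using far[OF True] False by (simp add: u_def)
          finally show ?thesis using True l by (simp add: F_def)
        qed (simp add: F_def)
        moreover have "H t \<le> exp (- l * (d * \<bar>u\<bar>))"
        proof -
          have "d * \<bar>u\<bar> \<le> \<kappa> * r / 2 * \<bar>u\<bar>" using d by (intro mult_right_mono) auto
          also have "\<dots> \<le> \<kappa> * \<bar>u\<bar> / 2 * \<bar>u\<bar>"
            using False pos by (intro mult_right_mono) auto
          also have "\<dots> = \<kappa> * u\<^sup>2 / 2" by (simp add: power2_eq_square)
          finally show ?thesis using l by (simp add: Ht)
        qed
        moreover have "0 \<le> F t" "0 \<le> H t" "0 \<le> \<Phi> t"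
          using l pos by (simp_all add: F_def H_def \<Phi>t)
        ultimately show ?thesis unfolding \<Psi>t by linarith
      qed
    qed
    have Hint: "integrable lborel H" "integral\<^sup>L lborel H = sqrt (2 * pi / (\<kappa> * l))"
      unfolding H_def using integral_gaussian[of "\<kappa> * l" p] pos l by simp_all
    have bound: "integrable lborel (\<lambda>t. \<Phi> t + \<Psi> t)" using \<Phi> \<Psi> by simp
    have [measurable]: "F \<in> borel_measurable borel" "H \<in> borel_measurable borel"
      unfolding F_def H_def by measurable
    have diff: "integrable lborel (\<lambda>t. F t - H t)"
      by (rule Bochner_Integration.integrable_bound[OF bound])
         (use pointwise in \<open>auto intro!: AE_I2 intro: order_trans[OF _ abs_ge_self]\<close>)
    from Bochner_Integration.integrable_add[OF this Hint(1)] have F: "integrable lborel F" by simp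
    thus "set_integrable lborel A (\<lambda>t. exp (- l * g t))" by (simp only: set_integrable_def F_def [abs_def])
    have "\<bar>integral\<^sup>L lborel F - integral\<^sup>L lborel H\<bar> = \<bar>LINT t|lborel. F t - H t\<bar>"
      using F Hint by simp
    also have "\<dots> \<le> (LINT t|lborel. \<bar>F t - H t\<bar>)" by (rule integral_abs_bound)
    also have "\<dots> \<le> (LINT t|lborel. \<Phi> t + \<Psi> t)"
      using diff bound pointwise by (intro integral_mono) auto
    also have "\<dots> = (K * J3 + 2 * J1) / l" using \<Phi> \<Psi> by (simp add: add_divide_distrib)
    finally show "\<bar>(LINT t:A|lborel. exp (- l * g t)) - sqrt (2 * pi / (\<kappa> * l))\<bar> \<le> (K * J3 + 2 * J1) / l"
      by (simp only: set_lebesgue_integral_def F_def [abs_def] Hint)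
  qed
qed

section \<open>The phase function\<close>

text \<open>
  The exponent \<open>c x powr \<theta> - v x\<close>, measured downwards from its maximum and rescaled so that the
  maximum lies at 1 and the slope at infinity is 1.
\<close>
definition phase :: "real \<Rightarrow> real \<Rightarrow> real" where
  "phase \<theta> t = t - 1 - (t powr \<theta> - 1) / \<theta>"

lemma phase_has_derivative:
  assumes "0 < \<theta>" "0 < t"
  shows "(phase \<theta> has_real_derivative 1 - t powr (\<theta> - 1)) (at t)"
  unfolding phase_def [abs_def] using assms by (auto intro!: derivative_eq_intros)

lemma continuous_on_phase: "0 < \<theta> \<Longrightarrow> continuous_on {0..} (phase \<theta>)"
  unfolding phase_def [abs_def] by (intro continuous_on_powr' continuous_intros) auto

lemma phase_antimono_below_1:
  assumes "0 < \<theta>" "\<theta> < 1" "0 \<le> s" "s \<le> t" "t \<le> 1"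
  shows "phase \<theta> t \<le> phase \<theta> s"
proof (rule DERIV_nonpos_imp_decreasing_open[OF assms(4)])
  fix x assume "s < x" "x < t"
  with assms have "0 < x" "x \<le> 1" by auto
  moreover from this have "1 \<le> x powr (\<theta> - 1)"
    using powr_mono2'[of "\<theta> - 1" x 1] assms by simp
  ultimately show "\<exists>y. (phase \<theta> has_real_derivative y) (at x) \<and> y \<le> 0"
    using phase_has_derivative[OF assms(1)] by fastforce
qed (rule continuous_on_subset[OF continuous_on_phase], use assms in auto)

lemma phase_mono_above_1:
  assumes "0 < \<theta>" "\<theta> < 1" "1 \<le> s" "s \<le> t"
  shows "phase \<theta> s \<le> phase \<theta> t"
proof (rule DERIV_nonneg_imp_nondecreasing[OF assms(4)])
  fix x assume "s \<le> x" "x \<le> t"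
  with assms have "1 \<le> x" by auto
  moreover from this have "x powr (\<theta> - 1) \<le> 1"
    using powr_mono2'[of "\<theta> - 1" 1 x] assms by simp
  ultimately show "\<exists>y. (phase \<theta> has_real_derivative y) (at x) \<and> 0 \<le> y"
    using phase_has_derivative[OF assms(1), of x] by (intro exI conjI) auto
qed

text \<open>
  The second derivative of the phase at 1 is \<open>1 - \<theta>\<close>. On \<open>[1/2, 3/2]\<close> it is at least
  \<open>(1 - \<theta>) (3/2) powr (- 2)\<close>, and the third derivative is at most \<open>16\<close> in absolute value; expansions
  of order three and two with Lagrange remainder give the two estimates.
\<close>
lemma phase_taylor:
  assumes \<theta>: "0 < \<theta>" "\<theta> < 1" and t: "\<bar>t - 1\<bar> \<le> 1 / 2"
  shows "\<bar>phase \<theta> t - (1 - \<theta>) * (t - 1)\<^sup>2 / 2\<bar> \<le> 3 * \<bar>t - 1\<bar> ^ 3"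
    and "(1 - \<theta>) * 2 / 9 * (t - 1)\<^sup>2 \<le> phase \<theta> t"
proof -
  define D :: "nat \<Rightarrow> real \<Rightarrow> real" where
    "D m = (case m of 0 \<Rightarrow> phase \<theta> | Suc 0 \<Rightarrow> (\<lambda>x. 1 - x powr (\<theta> - 1))
       | Suc (Suc 0) \<Rightarrow> (\<lambda>x. (1 - \<theta>) * x powr (\<theta> - 2))
       | _ \<Rightarrow> (\<lambda>x. - ((1 - \<theta>) * (2 - \<theta>)) * x powr (\<theta> - 3)))" for m
  have D: "D 0 = phase \<theta>" "D 1 = (\<lambda>x. 1 - x powr (\<theta> - 1))"
    "D (Suc 0) = (\<lambda>x. 1 - x powr (\<theta> - 1))"
    "D 2 = (\<lambda>x. (1 - \<theta>) * x powr (\<theta> - 2))"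
    "D 3 = (\<lambda>x. - ((1 - \<theta>) * (2 - \<theta>)) * x powr (\<theta> - 3))"
    by (simp_all add: D_def numeral_2_eq_2 numeral_3_eq_3)
  have at1: "D 0 1 = 0" "D 1 1 = 0" "D (Suc 0) 1 = 0" "D 2 1 = 1 - \<theta>" by (simp_all add: D phase_def)
  have deriv: "(D m has_real_derivative D (Suc m) x) (at x)" if "m < 3" "1 / 2 \<le> x" "x \<le> 3 / 2" for m x
  proof -
    consider "m = 0" | "m = 1" | "m = 2" using \<open>m < 3\<close> by linarith
    thus ?thesis
    proof cases
      case 1 thus ?thesis using phase_has_derivative[OF \<theta>(1), of x] that by (simp add: D)
    next
      case 2
      have "((\<lambda>x. 1 - x powr (\<theta> - 1)) has_real_derivative (1 - \<theta>) * x powr (\<theta> - 2)) (at x)"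
        using that by (auto intro!: derivative_eq_intros simp: algebra_simps)
      thus ?thesis using 2 D by (simp flip: numeral_2_eq_2)
    next
      case 3
      have "((\<lambda>x. (1 - \<theta>) * x powr (\<theta> - 2)) has_real_derivative
          - ((1 - \<theta>) * (2 - \<theta>)) * x powr (\<theta> - 3)) (at x)"
        using that by (auto intro!: derivative_eq_intros simp: algebra_simps)
      thus ?thesis using 3 D by (simp flip: numeral_3_eq_3)
    qed
  qed
  have *: "\<bar>phase \<theta> t - (1 - \<theta>) * (t - 1)\<^sup>2 / 2\<bar> \<le> 3 * \<bar>t - 1\<bar> ^ 3 \<and>
      (1 - \<theta>) * 2 / 9 * (t - 1)\<^sup>2 \<le> phase \<theta> t"
  proof (cases "t = 1")
    case True thus ?thesis by (simp add: phase_def)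
  next
    case False
    from t have range: "1 / 2 \<le> t" "t \<le> 3 / 2" by linarith+
    from Taylor[of 3 D "phase \<theta>" "1 / 2" "3 / 2" 1 t] deriv range False D(1)
    obtain x where x: "if t < 1 then t < x \<and> x < 1 else 1 < x \<and> x < t"
      and eq: "phase \<theta> t = (\<Sum>m<3. D m 1 / fact m * (t - 1) ^ m) + D 3 x / fact 3 * (t - 1) ^ 3"
      by auto
    from x range have x: "1 / 2 \<le> x" by (auto split: if_splits)
    have "x powr (\<theta> - 3) \<le> (1 / 2) powr (\<theta> - 3)" using x \<theta> by (intro powr_mono2') auto
    also have "\<dots> \<le> (1 / 2) powr (- 3)" using \<theta> by (intro powr_mono') auto
    also have "\<dots> = 8" by (simp add: powr_minus power3_eq_cube)
    finally have "(1 - \<theta>) * (2 - \<theta>) * x powr (\<theta> - 3) \<le> 1 * 2 * 8"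
      using \<theta> by (intro mult_mono) auto
    hence "\<bar>D 3 x\<bar> \<le> 16" using \<theta> by (simp add: D abs_mult)
    hence "\<bar>D 3 x / fact 3\<bar> * \<bar>t - 1\<bar> ^ 3 \<le> 3 * \<bar>t - 1\<bar> ^ 3"
      by (intro mult_right_mono) (auto simp: fact_numeral)
    moreover have "phase \<theta> t - (1 - \<theta>) * (t - 1)\<^sup>2 / 2 = D 3 x / fact 3 * (t - 1) ^ 3"
      using eq by (simp add: eval_nat_numeral at1 del: fact_Suc)
         (simp add: at1 flip: numeral_2_eq_2)
    ultimately have 1: "\<bar>phase \<theta> t - (1 - \<theta>) * (t - 1)\<^sup>2 / 2\<bar> \<le> 3 * \<bar>t - 1\<bar> ^ 3"
      by (simp only: abs_mult power_abs)
    from Taylor[of 2 D "phase \<theta>" "1 / 2" "3 / 2" 1 t] deriv range False D(1)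
    obtain y where y: "if t < 1 then t < y \<and> y < 1 else 1 < y \<and> y < t"
      and eq: "phase \<theta> t = (\<Sum>m<2. D m 1 / fact m * (t - 1) ^ m) + D 2 y / fact 2 * (t - 1) ^ 2"
      by auto
    from y range have y: "1 / 2 \<le> y" "y \<le> 3 / 2" by (auto split: if_splits)
    have "4 / 9 = (3 / 2) powr (- 2 :: real)" by (simp add: powr_minus power2_eq_square)
    also have "\<dots> \<le> (3 / 2) powr (\<theta> - 2)" using \<theta> by (intro powr_mono) auto
    also have "\<dots> \<le> y powr (\<theta> - 2)" using y \<theta> by (intro powr_mono2') auto
    finally have "(1 - \<theta>) * (4 / 9) \<le> D 2 y"
      unfolding D using \<theta> by (intro mult_left_mono) auto
    hence "(1 - \<theta>) * 2 / 9 * (t - 1)\<^sup>2 \<le> D 2 y / fact 2 * (t - 1)\<^sup>2"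
      by (intro mult_right_mono) auto
    also have "\<dots> = phase \<theta> t" using eq by (simp add: numeral_2_eq_2 at1)
    finally show ?thesis using 1 by blast
  qed
  thus "\<bar>phase \<theta> t - (1 - \<theta>) * (t - 1)\<^sup>2 / 2\<bar> \<le> 3 * \<bar>t - 1\<bar> ^ 3"
    and "(1 - \<theta>) * 2 / 9 * (t - 1)\<^sup>2 \<le> phase \<theta> t" by auto
qed

text \<open>
  To the left of 1 monotonicity and the boundedness of \<open>t - 1\<close> suffice. To the right the slope of the
  phase is at least its value \<open>s > 0\<close> at \<open>3/2\<close>. At both ends of the interval \<open>[1/2, 3/2]\<close> the
  quadratic lower bound supplies \<open>(1 - \<theta>) / 18\<close>.
\<close>
lemma phase_linear_growth:
  assumes \<theta>: "0 < \<theta>" "\<theta> < 1"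
  shows "\<exists>\<delta>>0. \<delta> \<le> (1 - \<theta>) / 18 \<and> (\<forall>t\<ge>0. 1 / 2 < \<bar>t - 1\<bar> \<longrightarrow> \<delta> * \<bar>t - 1\<bar> \<le> phase \<theta> t)"
proof -
  define s where "s = 1 - (3 / 2) powr (\<theta> - 1)"
  have "(3 / 2) powr (\<theta> - 1) < (3 / 2) powr 0" using \<theta> by (intro powr_less_mono) auto
  hence s: "s > 0" by (simp add: s_def)
  define \<delta> where "\<delta> = min ((1 - \<theta>) / 18) s"
  have \<delta>: "0 < \<delta>" "\<delta> \<le> (1 - \<theta>) / 18" "\<delta> \<le> s" using s \<theta> unfolding \<delta>_def by (simp_all only: min_less_iff_conj min.cobounded1 min.cobounded2, simp_all)
  have "\<delta> * \<bar>t - 1\<bar> \<le> phase \<theta> t" if t: "0 \<le> t" "1 / 2 < \<bar>t - 1\<bar>" for t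
  proof (cases "t \<le> 1")
    case True
    with t have "t \<le> 1 / 2" by linarith
    have "\<delta> * \<bar>t - 1\<bar> \<le> \<delta> * 1" using True t \<delta> by (intro mult_left_mono) auto
    also have "\<dots> \<le> phase \<theta> (1 / 2)"
      using phase_taylor(2)[OF \<theta>, of "1 / 2"] \<delta> by (simp add: power2_eq_square)
    also have "\<dots> \<le> phase \<theta> t"
      using \<open>t \<le> 1 / 2\<close> t by (intro phase_antimono_below_1 \<theta>) auto
    finally show ?thesis .
  next
    case False
    with t have t: "3 / 2 \<le> t" by linarith
    have "phase \<theta> (3 / 2) - s * (3 / 2) \<le> phase \<theta> t - s * t"
    proof (rule DERIV_nonneg_imp_nondecreasing[OF t])
      fix x :: real assume x: "3 / 2 \<le> x" "x \<le> t"
      have "((\<lambda>x. phase \<theta> x - s * x) has_real_derivative (1 - x powr (\<theta> - 1) - s * 1)) (at x)"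
        using x by (intro DERIV_diff phase_has_derivative \<theta> DERIV_cmult DERIV_ident) auto
      moreover have "x powr (\<theta> - 1) \<le> (3 / 2) powr (\<theta> - 1)"
        using x \<theta> by (intro powr_mono2') auto
      ultimately show "\<exists>y. ((\<lambda>x. phase \<theta> x - s * x) has_real_derivative y) (at x) \<and> 0 \<le> y"
        by (intro exI conjI) (auto simp: s_def)
    qed
    moreover have "\<delta> / 2 \<le> phase \<theta> (3 / 2)"
      using phase_taylor(2)[OF \<theta>, of "3 / 2"] \<delta> \<theta> by (simp add: power2_eq_square)
    moreover have "\<delta> * (t - 3 / 2) \<le> s * (t - 3 / 2)" using \<delta> t by (intro mult_right_mono) auto
    ultimately show ?thesis using t by (simp add: algebra_simps)
  qed
  thus ?thesis using \<delta> by blast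
qed

lemma phase_integral_asymp:
  assumes "0 < \<theta>" "\<theta> < 1"
  shows "\<exists>C\<ge>0. \<forall>l>0. set_integrable lborel {0..} (\<lambda>t. exp (- l * phase \<theta> t)) \<and>
           \<bar>(LINT t:{0..}|lborel. exp (- l * phase \<theta> t)) - sqrt (2 * pi / ((1 - \<theta>) * l))\<bar> \<le> C / l"
proof -
  obtain \<delta> where \<delta>: "0 < \<delta>" "\<delta> \<le> (1 - \<theta>) / 18"
    and far: "\<And>t. 0 \<le> t \<Longrightarrow> 1 / 2 < \<bar>t - 1\<bar> \<Longrightarrow> \<delta> * \<bar>t - 1\<bar> \<le> phase \<theta> t"
    using phase_linear_growth[OF assms] by blast
  have near: "\<delta> * (t - 1)\<^sup>2 \<le> phase \<theta> t" if "\<bar>t - 1\<bar> \<le> 1 / 2" for t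
  proof -
    have "\<delta> * (t - 1)\<^sup>2 \<le> (1 - \<theta>) * 2 / 9 * (t - 1)\<^sup>2"
      using \<delta> assms by (intro mult_right_mono) auto
    thus ?thesis using phase_taylor(2)[OF assms that] by simp
  qed
  have [measurable]: "phase \<theta> \<in> borel_measurable borel"
    unfolding phase_def [abs_def] by measurable
  show ?thesis
    by (rule laplace_method[where \<delta> = \<delta> and K = 3 and r = "1 / 2" and p = 1])
       (use \<delta> assms far near phase_taylor(1)[OF assms] in auto)
qed

section \<open>The sum near its saddle point\<close>

text \<open>
  The summand as a function of \<open>x\<close> rises from a nonnegative value to 1 at \<open>x = N\<close> and then decreases,
  so its variation is at most 2. Hence the sum differs by at most 2 from an integral over \<open>[0, \<infinity>)\<close>,
  which is \<open>N\<close> times the Laplace integral of the phase.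
\<close>
lemma saddle_point_sum_asymp:
  assumes "0 < \<theta>" "\<theta> < 1"
  shows "\<exists>C\<ge>0. \<forall>l N. 0 < l \<longrightarrow> 0 < N \<longrightarrow> summable (\<lambda>n. exp (- l * phase \<theta> (real (Suc n) / N))) \<longrightarrow>
           \<bar>(\<Sum>n. exp (- l * phase \<theta> (real (Suc n) / N))) - N * sqrt (2 * pi / ((1 - \<theta>) * l))\<bar>
             \<le> 2 + C * N / l"
proof -
  obtain C where C: "0 \<le> C"
    and lap: "\<And>l. 0 < l \<Longrightarrow> set_integrable lborel {0..} (\<lambda>t. exp (- l * phase \<theta> t)) \<and>
      \<bar>(LINT t:{0..}|lborel. exp (- l * phase \<theta> t)) - sqrt (2 * pi / ((1 - \<theta>) * l))\<bar> \<le> C / l"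
    using phase_integral_asymp[OF assms] by blast
  show ?thesis
  proof (intro exI[of _ C] conjI allI impI)
    fix l N :: real
    assume l: "0 < l" and N: "0 < N"
      and summ: "summable (\<lambda>n. exp (- l * phase \<theta> (real (Suc n) / N)))"
    define G where "G t = exp (- l * phase \<theta> t)" for t
    \<comment> \<open>The variation function of the unimodal \<open>G\<close>: it follows the rise, then reflects the descent.\<close>
    define W where "W t = (if t \<le> 1 then G t else 2 - G t)" for t
    have nonneg: "0 \<le> phase \<theta> t" if "0 \<le> t" for t
      using phase_antimono_below_1[OF assms, of t 1] phase_mono_above_1[OF assms, of 1 t] that
      by (cases "t \<le> 1") (auto simp: phase_def)
    have G: "0 \<le> G t" "0 \<le> t \<Longrightarrow> G t \<le> 1" for t
      using nonneg l by (simp_all add: G_def)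
    have var: "\<bar>G s - G t\<bar> \<le> W t - W s" if "0 \<le> s" "s \<le> t" for s t
    proof -
      have "G s \<le> G t" if "t \<le> 1"
        using phase_antimono_below_1[OF assms \<open>0 \<le> s\<close> \<open>s \<le> t\<close> that] l by (simp add: G_def)
      moreover have "G t \<le> G s" if "1 \<le> s"
        using phase_mono_above_1[OF assms that \<open>s \<le> t\<close>] l by (simp add: G_def)
      ultimately show ?thesis
        using G(2)[of s] G(2)[of t] that by (auto simp: W_def abs_if)
    qed
    have scale: "indicator {0..} (0 + N * t) *\<^sub>R G ((0 + N * t) / N) = indicator {0..} t *\<^sub>R G t" for t
      using N by (simp add: indicator_def zero_le_mult_iff)
    have "set_integrable lborel {0..} (\<lambda>x. G (x / N))"
      unfolding set_integrable_def
      using lap[OF l] N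
      by (subst lborel_integrable_real_affine_iff[where t = 0 and c = N, symmetric])
         (simp_all only: scale, simp_all add: G_def set_integrable_def)
    moreover have int: "(LINT x:{0..}|lborel. G (x / N)) = N * (LINT t:{0..}|lborel. G t)"
      unfolding set_lebesgue_integral_def using N
      by (subst lborel_integral_real_affine[where t = 0 and c = N]) (simp_all only: scale, simp_all)
    ultimately have "\<bar>(\<Sum>n. G (real (Suc n) / N)) - (LINT x:{0..}|lborel. G (x / N))\<bar> \<le> 2"
    proof (intro abs_suminf_minus_integral_le_variation[where V = "\<lambda>x. W (x / N)"])
      show "summable (\<lambda>n. G (real (Suc n) / N))" using summ by (simp add: G_def)
      show "\<bar>G (x / N) - G (y / N)\<bar> \<le> W (y / N) - W (x / N)" if "0 \<le> x" "x \<le> y" for x y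
        using that N by (intro var) (auto simp: divide_right_mono)
      show "0 \<le> W (x / N) \<and> W (x / N) \<le> 2" if "0 \<le> x" for x
        using G(1)[of "x / N"] G(2)[of "x / N"] that N by (auto simp: W_def)
    qed
    moreover have "\<bar>(LINT x:{0..}|lborel. G (x / N)) - N * sqrt (2 * pi / ((1 - \<theta>) * l))\<bar> \<le> C * N / l"
    proof -
      have "\<bar>(LINT x:{0..}|lborel. G (x / N)) - N * sqrt (2 * pi / ((1 - \<theta>) * l))\<bar>
          = N * \<bar>(LINT t:{0..}|lborel. G t) - sqrt (2 * pi / ((1 - \<theta>) * l))\<bar>"
        unfolding int using N by (simp add: abs_mult flip: right_diff_distrib)
      also have "\<dots> \<le> N * (C / l)"
        using lap[OF l] N by (intro mult_left_mono) (auto simp: G_def)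
      finally show ?thesis by (simp add: mult_ac)
    qed
    ultimately show "\<bar>(\<Sum>n. exp (- l * phase \<theta> (real (Suc n) / N))) - N * sqrt (2 * pi / ((1 - \<theta>) * l))\<bar>
        \<le> 2 + C * N / l" unfolding G_def by linarith
  qed (rule C)
qed

text \<open>
  The derivative of \<open>c x powr \<theta> - v x\<close> vanishes exactly at \<open>N\<close>, that is, \<open>c \<theta> N powr (\<theta> - 1) = v\<close>.
  Consequently \<open>c N powr \<theta> = v N / \<theta>\<close>, and \<open>v N\<close> becomes the factor in front of the phase; the maximal
  value \<open>v N (1 - \<theta>) / \<theta>\<close> is the term with \<open>C2\<close>.
\<close>
lemma exponent_eq_max_minus_phase:
  assumes c: "0 < c" and \<theta>: "0 < \<theta>" "\<theta> < 1" and v: "0 < v" and x: "0 < x"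
  defines "N \<equiv> (c * \<theta> / v) powr (1 / (1 - \<theta>))"
  shows "c * x powr \<theta> - v * x = C2 c \<theta> * v powr (\<theta> / (\<theta> - 1)) - v * N * phase \<theta> (x / N)"
proof -
  have N: "0 < N" using assms by (simp add: N_def)
  have Npow: "N powr (1 - \<theta>) = c * \<theta> / v" using assms by (simp add: N_def powr_powr)
  have "v * N = v * N powr \<theta> * N powr (1 - \<theta>)" using N by (simp flip: powr_add mult.assoc)
  hence vN: "v * N = c * \<theta> * N powr \<theta>" using v by (simp add: Npow)
  have "N = (c * \<theta>) powr (1 / (1 - \<theta>)) * v powr (- 1 / (1 - \<theta>))"
    using c \<theta> v by (simp add: N_def powr_divide powr_minus_divide)
  hence "v * N = (c * \<theta>) powr (1 / (1 - \<theta>)) * (v powr 1 * v powr (- 1 / (1 - \<theta>)))"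
    using v by simp
  also have "v powr 1 * v powr (- 1 / (1 - \<theta>)) = v powr (\<theta> / (\<theta> - 1))"
    using \<theta> by (subst powr_add[symmetric]) (auto intro!: arg_cong[where f = "(powr) v"] simp: field_simps)
  finally have C2: "C2 c \<theta> * v powr (\<theta> / (\<theta> - 1)) = v * N * ((1 - \<theta>) / \<theta>)"
    by (simp add: C2_def)
  have "v * N * (((x / N) powr \<theta>) / \<theta>) = c * x powr \<theta>"
    unfolding vN using N x \<theta> by (simp add: powr_divide)
  moreover have "v * N * (x / N) = v * x" using N by simp
  ultimately show ?thesis
    unfolding C2 phase_def using \<theta>(1) by (simp add: algebra_simps diff_divide_distrib)
qed

text \<open>
  With the large parameter \<open>l = v N\<close>, the Gaussian main term produces \<open>C1\<close> and the power of \<open>v\<close>, and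
  the relative error \<open>1 / \<surd>l\<close> produces the exponent \<open>\<theta> / (2 (1 - \<theta>))\<close> of the error term.
\<close>
lemma saddle_point_prefactor:
  assumes c: "0 < c" and \<theta>: "0 < \<theta>" "\<theta> < 1" and v: "0 < v"
  defines "N \<equiv> (c * \<theta> / v) powr (1 / (1 - \<theta>))"
  shows "N * sqrt (2 * pi / ((1 - \<theta>) * (v * N))) = C1 c \<theta> * v powr ((2 - \<theta>) / (2 * (\<theta> - 1)))"
    and "1 / sqrt (v * N) = (c * \<theta>) powr (- 1 / (2 * (1 - \<theta>))) * v powr (\<theta> / (2 * (1 - \<theta>)))"
proof -
  define a where "a = 1 / (1 - \<theta>)"
  have N: "N = (c * \<theta>) powr a * v powr (- a)"
    using c \<theta> v by (simp add: N_def a_def powr_divide powr_minus_divide)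
  have pos: "0 < N" "0 < c * \<theta>" using assms by (simp_all add: N_def)
  have "N * sqrt (2 * pi / ((1 - \<theta>) * (v * N))) = sqrt (2 * pi) * (1 - \<theta>) powr (- 1 / 2) * (N * (v * N) powr (- 1 / 2))"
  proof -
    define \<kappa> where "\<kappa> = 1 - \<theta>"
    have "0 < \<kappa>" using \<theta> by (simp add: \<kappa>_def)
    thus ?thesis unfolding \<kappa>_def [symmetric]
      using pos v by (simp add: powr_half_sqrt powr_minus_divide real_sqrt_divide real_sqrt_mult)
  qed
  also have "N * (v * N) powr (- 1 / 2) = N powr (1 / 2) * v powr (- 1 / 2)"
    using pos v by (simp add: powr_mult) (simp flip: powr_add add: powr_mult_base)
  also have "\<dots> = (c * \<theta>) powr (a / 2) * v powr (- a / 2 - 1 / 2)"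
    using pos v by (simp add: N powr_mult powr_powr mult.assoc flip: powr_add)
  also have "a / 2 = 1 / (2 * (1 - \<theta>))" by (simp add: a_def)
  also have "- a / 2 - 1 / 2 = (2 - \<theta>) / (2 * (\<theta> - 1))" using \<theta> by (simp add: a_def field_simps)
  finally show "N * sqrt (2 * pi / ((1 - \<theta>) * (v * N))) = C1 c \<theta> * v powr ((2 - \<theta>) / (2 * (\<theta> - 1)))"
    by (simp add: C1_def)
  have "1 / sqrt (v * N) = (v * N) powr (- 1 / 2)"
    using pos v by (simp add: powr_minus_divide powr_half_sqrt)
  also have "\<dots> = (c * \<theta>) powr (- a / 2) * v powr (a / 2 - 1 / 2)"
    using pos v by (simp add: N powr_mult powr_powr mult_ac flip: powr_add)
  also have "- a / 2 = - 1 / (2 * (1 - \<theta>))" by (simp add: a_def)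
  also have "a / 2 - 1 / 2 = \<theta> / (2 * (1 - \<theta>))" using \<theta> by (simp add: a_def field_simps)
  finally show "1 / sqrt (v * N) = (c * \<theta>) powr (- 1 / (2 * (1 - \<theta>))) * v powr (\<theta> / (2 * (1 - \<theta>)))" .
qed

lemma C1_pos: "0 < c \<Longrightarrow> 0 < \<theta> \<Longrightarrow> \<theta> < 1 \<Longrightarrow> 0 < C1 c \<theta>"
  and C2_pos: "0 < c \<Longrightarrow> 0 < \<theta> \<Longrightarrow> \<theta> < 1 \<Longrightarrow> 0 < C2 c \<theta>"
  by (simp_all add: C1_def C2_def)

section \<open>Asymptotics of \<open>E\<close>\<close>

text \<open>
  With \<open>l = v N\<close>, the sum divided by its main term of order \<open>N / \<surd>l\<close> has error at most
  \<open>(2 + C N / l) \<surd>l / N = (2 v + C) / \<surd>l\<close>. Here \<open>2 v\<close> comes from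
  replacing the sum by the integral and \<open>C\<close> from Laplace's method, which therefore determines the order
  of the error.
\<close>
lemma E_asymp_exp:
  assumes c: "0 < c" and \<theta>: "0 < \<theta>" "\<theta> < 1"
  shows "(\<lambda>v. E (- exp (- v)) c \<theta>
            / (C1 c \<theta> * v powr ((2 - \<theta>) / (2 * (\<theta> - 1))) * exp (C2 c \<theta> * v powr (\<theta> / (\<theta> - 1)))) - 1)
         \<in> O[at_right 0](\<lambda>v. v powr (\<theta> / (2 * (1 - \<theta>))))"
proof -
  obtain C where C: "0 \<le> C" and asymp: "\<And>l N. 0 < l \<Longrightarrow> 0 < N \<Longrightarrow>
      summable (\<lambda>n. exp (- l * phase \<theta> (real (Suc n) / N))) \<Longrightarrow>
      \<bar>(\<Sum>n. exp (- l * phase \<theta> (real (Suc n) / N))) - N * sqrt (2 * pi / ((1 - \<theta>) * l))\<bar> \<le> 2 + C * N / l"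
    using saddle_point_sum_asymp[OF \<theta>] by blast
  define K where "K = (2 + C) * (c * \<theta>) powr (- 1 / (2 * (1 - \<theta>)))"
  have bound: "\<bar>E (- exp (- v)) c \<theta>
      / (C1 c \<theta> * v powr ((2 - \<theta>) / (2 * (\<theta> - 1))) * exp (C2 c \<theta> * v powr (\<theta> / (\<theta> - 1)))) - 1\<bar>
      \<le> K * v powr (\<theta> / (2 * (1 - \<theta>)))" if v: "0 < v" "v < 1" for v
  proof -
    define N where "N = (c * \<theta> / v) powr (1 / (1 - \<theta>))"
    define l where "l = v * N"
    define M where "M = exp (C2 c \<theta> * v powr (\<theta> / (\<theta> - 1)))"
    define T where "T n = exp (- l * phase \<theta> (real (Suc n) / N))" for n
    define P where "P = N * sqrt (2 * pi / ((1 - \<theta>) * l))"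
    have pos: "0 < N" "0 < l" "0 < M" "0 < P" using c \<theta> v by (simp_all add: N_def l_def M_def P_def)
    have P: "P = C1 c \<theta> * v powr ((2 - \<theta>) / (2 * (\<theta> - 1)))"
      using saddle_point_prefactor(1)[OF c \<theta> v(1)] by (simp add: P_def l_def N_def)
    have l: "1 / sqrt l = (c * \<theta>) powr (- 1 / (2 * (1 - \<theta>))) * v powr (\<theta> / (2 * (1 - \<theta>)))"
      using saddle_point_prefactor(2)[OF c \<theta> v(1)] by (simp add: l_def N_def)
    have summand: "exp (c * of_real (real (Suc n) powr \<theta>)) * (- (- exp (- v))) ^ Suc n = M * T n" for n
    proof -
      have "exp (c * of_real (real (Suc n) powr \<theta>)) * (- (- exp (- v))) ^ Suc n
          = exp (c * real (Suc n) powr \<theta> - v * real (Suc n))"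
        unfolding minus_minus exp_of_nat_mult [symmetric] of_real_eq_id id_apply exp_add [symmetric]
        by (simp only: mult_minus_left mult_minus_right add_uminus_conv_diff mult.commute)
      also have "\<dots> = M * T n"
        using exponent_eq_max_minus_phase[OF c \<theta> v(1), of "real (Suc n)"]
        by (simp add: M_def T_def l_def N_def flip: exp_add)
      finally show ?thesis .
    qed
    have "summable (\<lambda>n. M * T n)"
      using summable_E[OF \<theta>, of "- exp (- v)" c] v unfolding summand by simp
    hence summ: "summable T" using pos by simp
    have E: "E (- exp (- v)) c \<theta> = M * suminf T"
      unfolding E_def summand using summ by (rule suminf_mult)
    have "\<bar>suminf T - P\<bar> \<le> 2 + C * N / l"
      using asymp[OF pos(2,1)] summ by (simp add: T_def [abs_def] P_def)
    hence "\<bar>suminf T - P\<bar> / P \<le> (2 + C * N / l) / P"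
      using pos by (intro divide_right_mono) auto
    moreover have "suminf T / P - 1 = (suminf T - P) / P"
      using pos by (simp add: diff_divide_distrib)
    ultimately have "\<bar>suminf T / P - 1\<bar> \<le> (2 + C * N / l) / P"
      using pos by (simp add: abs_divide)
    also have "\<dots> \<le> (2 + C * N / l) / (N / sqrt l)"
    proof (rule divide_left_mono)
      \<comment> \<open>The main term is at least \<open>N / \<surd>l\<close>, which replaces it in the denominator.\<close>
      have "1 \<le> 2 * pi / (1 - \<theta>)" using \<theta> pi_gt3 by (simp add: field_simps)
      hence "1 / l \<le> 2 * pi / (1 - \<theta>) / l" using pos by (intro divide_right_mono) auto
      hence "sqrt (1 / l) \<le> sqrt (2 * pi / ((1 - \<theta>) * l))" by (simp add: divide_divide_eq_left)
      thus "N / sqrt l \<le> P" using pos mult_left_mono[of "1 / sqrt l" "sqrt (2 * pi / ((1 - \<theta>) * l))" N]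
        by (simp add: P_def real_sqrt_divide)
    qed (use pos C in auto)
    also have "\<dots> = (2 * v + C) * (1 / sqrt l)"
    proof -
      define q where "q = sqrt l"
      have q: "0 < q" "l = q * q" using pos by (simp_all add: q_def)
      have Nq: "N = q * q / v" using q(2) v by (simp add: l_def field_simps)
      show ?thesis unfolding q_def [symmetric] q(2) Nq using q(1) v by (simp add: field_simps)
    qed
    also have "\<dots> \<le> (2 + C) * (1 / sqrt l)" using v pos by (intro mult_right_mono) auto
    also have "\<dots> = K * v powr (\<theta> / (2 * (1 - \<theta>)))" unfolding l K_def by (simp add: mult_ac)
    finally have "\<bar>suminf T / P - 1\<bar> \<le> K * v powr (\<theta> / (2 * (1 - \<theta>)))" .
    moreover have "E (- exp (- v)) c \<theta> / (P * M) = suminf T / P" using pos by (simp add: E)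
    ultimately show ?thesis by (simp only: P M_def)
  qed
  show ?thesis
    by (rule bigoI[of _ K], rule eventually_at_rightI[of 0 1]) (use bound in auto)
qed

theorem proposition4:
  fixes c \<theta> \<epsilon> :: real
  assumes "c > 0" and "0 < \<theta>" and "\<theta> < 1" and "\<epsilon> > 0"
  shows "C1 c \<theta> > 0 \<and> C2 c \<theta> > 0 \<and>
    (let \<mu> = min (\<theta> / (2 * (1 - \<theta>)) - \<epsilon>) 1 in
     \<exists>R :: real \<Rightarrow> real.
       R \<in> O[at_right (- 1)](\<lambda>z. (1 + z) powr \<mu>) \<and>
       (\<forall>\<^sub>F z in at_right (- 1).
          let v = - ln \<bar>z\<bar> in
          E z c \<theta> = C1 c \<theta> * (1 + z) powr ((2 - \<theta>) / (2 * (\<theta> - 1)))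
            * exp (C2 c \<theta> * v powr (\<theta> / (\<theta> - 1))) * (1 + R z)))"
proof -
  define \<mu> where "\<mu> = min (\<theta> / (2 * (1 - \<theta>)) - \<epsilon>) 1"
  define a where "a = (2 - \<theta>) / (2 * (\<theta> - 1))"
  define b where "b = \<theta> / (2 * (1 - \<theta>))"
  define X where "X v = exp (C2 c \<theta> * v powr (\<theta> / (\<theta> - 1)))" for v
  define r where "r v = E (- exp (- v)) c \<theta> / (C1 c \<theta> * v powr a * X v) - 1" for v
  \<comment> \<open>Near \<open>-1\<close> the argument is negative, so \<open>\<bar>z\<bar> = - z\<close>. The error \<open>R\<close> collects the error \<open>r\<close> of
      the expansion in \<open>v\<close> and the ratio of the powers of \<open>v\<close> and \<open>1 + z\<close>.\<close>
  define v where "v z = - ln (- z)" for z :: real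
  define R where "R z = (1 + r (v z)) * (v z / (1 + z)) powr a - 1" for z
  note C1 = C1_pos[OF assms(1-3)] and C2 = C2_pos[OF assms(1-3)]
  have range: "\<forall>\<^sub>F z in at_right (- 1 :: real). - 1 < z \<and> z < 0"
    by (rule eventually_at_rightI[of "- 1" 0]) auto
  have weaken: "(\<lambda>z. (1 + z) powr p) \<in> O[at_right (- 1)](\<lambda>z. (1 + z) powr \<mu>)" if "\<mu> \<le> p" for p :: real
    by (rule bigoI[of _ 1], rule eventually_mono[OF range])
       (use that in \<open>auto intro: powr_mono'\<close>)
  have r_bigo: "(\<lambda>z. r (v z)) \<in> O[at_right (- 1)](\<lambda>z. (1 + z) powr \<mu>)"
  proof -
    have "r \<in> O[at_right 0](\<lambda>v. v powr b)"
      using E_asymp_exp[OF assms(1-3)] by (simp only: r_def [abs_def] X_def a_def b_def)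
    moreover have "filterlim v (at_right 0) (at_right (- 1))"
      unfolding v_def [abs_def] by real_asymp
    ultimately have "(\<lambda>z. r (v z)) \<in> O[at_right (- 1)](\<lambda>z. v z powr b)"
      by (rule landau_o.big.compose)
    also have "(\<lambda>z. v z powr b) \<in> O[at_right (- 1)](\<lambda>z. (1 + z) powr b)"
      unfolding v_def by real_asymp
    also have "(\<lambda>z. (1 + z) powr b) \<in> O[at_right (- 1)](\<lambda>z. (1 + z) powr \<mu>)"
      using assms(4) by (intro weaken) (simp add: \<mu>_def b_def)
    finally show ?thesis .
  qed
  have "R \<in> O[at_right (- 1)](\<lambda>z. (1 + z) powr \<mu>)"
  proof -
    have "(\<lambda>z. (v z / (1 + z)) powr a) \<in> O[at_right (- 1)](\<lambda>_. 1)"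
      unfolding v_def by real_asymp
    from landau_o.big.mult[OF r_bigo this]
    have 1: "(\<lambda>z. r (v z) * (v z / (1 + z)) powr a) \<in> O[at_right (- 1)](\<lambda>z. (1 + z) powr \<mu>)"
      by simp
    \<comment> \<open>As \<open>v = (1 + z) + O((1 + z)\<^sup>2)\<close>, this change of prefactor costs an error of first order.\<close>
    have "(\<lambda>z. (v z / (1 + z)) powr a - 1) \<in> O[at_right (- 1)](\<lambda>z. (1 + z) powr 1)"
      unfolding v_def by real_asymp
    also have "(\<lambda>z. (1 + z) powr 1) \<in> O[at_right (- 1)](\<lambda>z. (1 + z) powr \<mu>)"
      by (intro weaken) (simp add: \<mu>_def)
    finally have "(\<lambda>z. r (v z) * (v z / (1 + z)) powr a + ((v z / (1 + z)) powr a - 1))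
        \<in> O[at_right (- 1)](\<lambda>z. (1 + z) powr \<mu>)"
      by (rule sum_in_bigo(1)[OF 1])
    also have "(\<lambda>z. r (v z) * (v z / (1 + z)) powr a + ((v z / (1 + z)) powr a - 1)) = R"
      by (auto simp: R_def algebra_simps)
    finally show ?thesis .
  qed
  moreover have "\<forall>\<^sub>F z in at_right (- 1). E z c \<theta> = C1 c \<theta> * (1 + z) powr a * X (- ln \<bar>z\<bar>) * (1 + R z)"
    using range
  proof eventually_elim
    case (elim z)
    hence z: "0 < v z" "exp (- v z) = - z" "- ln \<bar>z\<bar> = v z" by (auto simp: v_def)
    have "E z c \<theta> = C1 c \<theta> * v z powr a * X (v z) * (1 + r (v z))"
      using C1 z by (simp add: r_def X_def)
    also have "v z powr a = (1 + z) powr a * (v z / (1 + z)) powr a"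
      using z elim by (simp add: powr_divide)
    finally show ?case unfolding z by (simp add: R_def mult_ac)
  qed
  ultimately show ?thesis
    using C1 C2 unfolding Let_def \<mu>_def X_def a_def by blast
qed

end
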